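(* Let $\lambda_0,\lambda_1>0$. Let $\bm{M}_0^\star$ be the optimal solution of the primal problem for $\lambda_0$ and let $(\bm{\alpha}_0^\star,\bm{\Gamma}_0^\star)$ be optimal for the dual problem for $\lambda_0$. Suppose that $\bm{M}_0^\star,\bm{\alpha}_0^\star,\bm{\Gamma}_0^\star$ are used as the reference solutions $\bm{M},\bm{\alpha},\bm{\Gamma}$ of the Duality Gap Bound (DGB) for $\lambda_1$. Then the radii of DGB and of the Regularization Path Bound (RPB) for $\lambda_1$ satisfy $r_{\mathrm{DGB}}=2\,r_{\mathrm{RPB}}$, and the hypersphere (closed ball) of RPB is included in the hypersphere (closed ball) of DGB.
   Context: Let $\bm{x}_1,\dots,\bm{x}_n\in\mathbb{R}^d$ have labels $y_1,\dots,y_n$ in a discrete set, and let $\mathcal{T}=\{(i,j,l)\in\{1,\dots,n\}^3\mid y_i=y_j,\ i\neq j,\ y_i\neq y_l\}$. For $(i,j,l)\in\mathcal{T}$ put $\bm{H}_{ijl}=(\bm{x}_i-\bm{x}_l)(\bm{x}_i-\bm{x}_l)^\top-(\bm{x}_i-\bm{x}_j)(\bm{x}_i-\bm{x}_j)^\top$. $\langle \bm{A},\bm{B}\rangle=\mathrm{tr}(\bm{A}^\top\bm{B})$, $\|\bm{A}\|_F^2=\langle\bm{A},\bm{A}\rangle$, and $\bm{M}\succeq\bm{O}$ means that $\bm{M}\in\mathbb{R}^{d\times d}$ is (symmetric) positive semi-definite. The loss $\ell:\mathbb{R}\to\mathbb{R}$ is either the hinge loss $\ell(x)=\max\{0,1-x\}$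 (parameter $\gamma=0$), or, for a parameter $\gamma>0$, the smoothed hinge loss: $\ell(x)=0$ for $x>1$, $\ell(x)=\frac{1}{2\gamma}(1-x)^2$ for $1-\gamma\le x\le1$, $\ell(x)=1-x-\frac{\gamma}{2}$ for $x<1-\gamma$. Primal problem for $\lambda>0$: minimize $P_\lambda(\bm{M})=\sum_{(i,j,l)\in\mathcal{T}}\ell(\langle\bm{M},\bm{H}_{ijl}\rangle)+\frac{\lambda}{2}\|\bm{M}\|_F^2$ over $\bm{M}\succeq\bm{O}$. Dual problem for $\lambda>0$: maximize $D_\lambda(\bm{\alpha},\bm{\Gamma})=-\frac{\gamma}{2}\|\bm{\alpha}\|_2^2+\bm{\alpha}^\top\bm{1}-\frac{\lambda}{2}\|\bm{M}_\lambda(\bm{\alpha},\bm{\Gamma})\|_F^2$ over $\bm{\alpha}=(\alpha_{ijl})\in\mathbb{R}^{|\mathcal{T}|}$ with $\bm{0}\le\bm{\alpha}\le\bm{1}$ (componentwise) and $\bm{\Gamma}\succeq\bm{O}$, where $\bm{M}_\lambda(\bm{\alpha},\bm{\Gamma})=\frac{1}{\lambda}\left[\sum_{(i,j,l)\in\mathcal{T}}\alpha_{ijl}\bm{H}_{ijl}+\bm{\Gamma}\right]$. DGB for $\lambda$ with reference solutions $\bm{M},\bm{\alpha},\bm{\Gamma}$: the ball (in Frobenius norm) with center $\bm{M}$ and radius $r_{\mathrm{DGB}}=\sqrt{2(P_\lambda(\bm{M})-D_\lambda(\bm{\alpha},\bm{\Gamma}))/\lambda}$. RPB for $\lambda_1$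 based on $\lambda_0$: the ball with center $\frac{\lambda_0+\lambda_1}{2\lambda_1}\bm{M}_0^\star$ and radius $r_{\mathrm{RPB}}=\frac{|\lambda_0-\lambda_1|}{2\lambda_1}\|\bm{M}_0^\star\|_F$. *)

theory Defs
  imports "HOL-Analysis.Analysis"
begin

definition frob_inner :: "real^'d^'d \<Rightarrow> real^'d^'d \<Rightarrow> real" where
  "frob_inner A B = trace (transpose A ** B)"

definition frob_norm :: "real^'d^'d \<Rightarrow> real" where
  "frob_norm A = sqrt (frob_inner A A)"

definition frob_cball :: "real^'d^'d \<Rightarrow> real \<Rightarrow> (real^'d^'d) set" where
  "frob_cball C r = {X. frob_norm (X - C) \<le> r}"

definition psd :: "real^'d^'d \<Rightarrow> bool" where
  "psd A \<longleftrightarrow> transpose A = A \<and> (\<forall>v. 0 \<le> v \<bullet> (A *v v))"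

definition triplets :: "nat \<Rightarrow> (nat \<Rightarrow> 'label) \<Rightarrow> (nat \<times> nat \<times> nat) set" where
  "triplets n y = {(i, j, l). i \<in> {1..n} \<and> j \<in> {1..n} \<and> l \<in> {1..n} \<and>
                              y i = y j \<and> i \<noteq> j \<and> y i \<noteq> y l}"

definition outer_square :: "real^'d \<Rightarrow> real^'d^'d" where
  "outer_square v = (columnvector v :: real^1^'d) ** (rowvector v :: real^'d^1)"

fun H :: "(nat \<Rightarrow> real^'d) \<Rightarrow> nat \<times> nat \<times> nat \<Rightarrow> real^'d^'d" where
  "H x (i, j, l) = outer_square (x i - x l) - outer_square (x i - x j)"

text \<open>Hinge loss for \<open>\<gamma> = 0\<close>, smoothed hinge loss with parameter \<open>\<gamma>\<close> for \<open>\<gamma> > 0\<close>.\<close>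

definition loss :: "real \<Rightarrow> real \<Rightarrow> real" where
  "loss \<gamma> z =
     (if \<gamma> = 0 then max 0 (1 - z)
      else if z > 1 then 0
      else if 1 - \<gamma> \<le> z then 1 / (2 * \<gamma>) * (1 - z)\<^sup>2
      else 1 - z - \<gamma> / 2)"

definition primal_obj ::
  "real \<Rightarrow> nat \<Rightarrow> (nat \<Rightarrow> real^'d) \<Rightarrow> (nat \<Rightarrow> 'label) \<Rightarrow> real \<Rightarrow> real^'d^'d \<Rightarrow> real" where
  "primal_obj \<gamma> n x y lam M =
     (\<Sum>t\<in>triplets n y. loss \<gamma> (frob_inner M (H x t))) + lam / 2 * (frob_norm M)\<^sup>2"

text \<open>A dual vector, indexed by the triplets, is represented by a function on all of
  \<open>nat \<times> nat \<times> nat\<close>; its values outside \<open>triplets n y\<close> are unconstrained and occur nowhere.\<close>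

definition dual_matrix ::
  "nat \<Rightarrow> (nat \<Rightarrow> real^'d) \<Rightarrow> (nat \<Rightarrow> 'label) \<Rightarrow> real \<Rightarrow>
   (nat \<times> nat \<times> nat \<Rightarrow> real) \<Rightarrow> real^'d^'d \<Rightarrow> real^'d^'d" where
  "dual_matrix n x y lam \<alpha> \<Gamma> = (1 / lam) *\<^sub>R ((\<Sum>t\<in>triplets n y. \<alpha> t *\<^sub>R H x t) + \<Gamma>)"

definition dual_obj ::
  "real \<Rightarrow> nat \<Rightarrow> (nat \<Rightarrow> real^'d) \<Rightarrow> (nat \<Rightarrow> 'label) \<Rightarrow> real \<Rightarrow>
   (nat \<times> nat \<times> nat \<Rightarrow> real) \<Rightarrow> real^'d^'d \<Rightarrow> real" where
  "dual_obj \<gamma> n x y lam \<alpha> \<Gamma> =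
     - (\<gamma> / 2) * (\<Sum>t\<in>triplets n y. (\<alpha> t)\<^sup>2) + (\<Sum>t\<in>triplets n y. \<alpha> t)
     - lam / 2 * (frob_norm (dual_matrix n x y lam \<alpha> \<Gamma>))\<^sup>2"

definition dual_feasible ::
  "nat \<Rightarrow> (nat \<Rightarrow> 'label) \<Rightarrow> (nat \<times> nat \<times> nat \<Rightarrow> real) \<Rightarrow> real^'d^'d \<Rightarrow> bool" where
  "dual_feasible n y \<alpha> \<Gamma> \<longleftrightarrow> (\<forall>t\<in>triplets n y. 0 \<le> \<alpha> t \<and> \<alpha> t \<le> 1) \<and> psd \<Gamma>"

definition primal_optimal ::
  "real \<Rightarrow> nat \<Rightarrow> (nat \<Rightarrow> real^'d) \<Rightarrow> (nat \<Rightarrow> 'label) \<Rightarrow> real \<Rightarrow> real^'d^'d \<Rightarrow> bool" where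
  "primal_optimal \<gamma> n x y lam M \<longleftrightarrow> is_arg_min (primal_obj \<gamma> n x y lam) psd M"

definition dual_optimal ::
  "real \<Rightarrow> nat \<Rightarrow> (nat \<Rightarrow> real^'d) \<Rightarrow> (nat \<Rightarrow> 'label) \<Rightarrow> real \<Rightarrow>
   (nat \<times> nat \<times> nat \<Rightarrow> real) \<Rightarrow> real^'d^'d \<Rightarrow> bool" where
  "dual_optimal \<gamma> n x y lam \<alpha> \<Gamma> \<longleftrightarrow>
     is_arg_max (\<lambda>(a, G). dual_obj \<gamma> n x y lam a G) (\<lambda>(a, G). dual_feasible n y a G) (\<alpha>, \<Gamma>)"

definition dgb_radius ::
  "real \<Rightarrow> nat \<Rightarrow> (nat \<Rightarrow> real^'d) \<Rightarrow> (nat \<Rightarrow> 'label) \<Rightarrow> real \<Rightarrow> real^'d^'d \<Rightarrow>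
   (nat \<times> nat \<times> nat \<Rightarrow> real) \<Rightarrow> real^'d^'d \<Rightarrow> real" where
  "dgb_radius \<gamma> n x y lam M \<alpha> \<Gamma> =
     sqrt (2 * (primal_obj \<gamma> n x y lam M - dual_obj \<gamma> n x y lam \<alpha> \<Gamma>) / lam)"

definition dgb ::
  "real \<Rightarrow> nat \<Rightarrow> (nat \<Rightarrow> real^'d) \<Rightarrow> (nat \<Rightarrow> 'label) \<Rightarrow> real \<Rightarrow> real^'d^'d \<Rightarrow>
   (nat \<times> nat \<times> nat \<Rightarrow> real) \<Rightarrow> real^'d^'d \<Rightarrow> (real^'d^'d) set" where
  "dgb \<gamma> n x y lam M \<alpha> \<Gamma> = frob_cball M (dgb_radius \<gamma> n x y lam M \<alpha> \<Gamma>)"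

definition rpb_radius :: "real \<Rightarrow> real \<Rightarrow> real^'d^'d \<Rightarrow> real" where
  "rpb_radius lam0 lam1 M0 = \<bar>lam0 - lam1\<bar> / (2 * lam1) * frob_norm M0"

definition rpb :: "real \<Rightarrow> real \<Rightarrow> real^'d^'d \<Rightarrow> (real^'d^'d) set" where
  "rpb lam0 lam1 M0 = frob_cball (((lam0 + lam1) / (2 * lam1)) *\<^sub>R M0) (rpb_radius lam0 lam1 M0)"

end

theory Submission
  imports Defs
begin

text \<open>
  The first-order conditions at the dual optimum say that its matrix
  \<open>M = dual_matrix n x y lam0 \<alpha>0 \<Gamma>0\<close> lies in the dual cone of the positive semi-definite cone and is
  orthogonal to \<open>\<Gamma>0\<close>, and that each \<open>\<alpha>0 t\<close> attains equality in the Fenchel--Young inequality for the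
  loss. Hence \<open>M\<close> is primal feasible with zero duality gap, and strong convexity of the primal
  objective gives \<open>M0 = M\<close>. Passing from \<open>lam0\<close> to \<open>lam1\<close> changes only the quadratic terms, so the gap
  becomes \<open>(lam0 - lam1)\<^sup>2 / (2 * lam1) * \<parallel>M0\<parallel>\<^sup>2\<close>; the inclusion is then the triangle inequality, as the
  distance of the two centers is exactly the radius of RPB.
\<close>

section \<open>Frobenius geometry and rank-one matrices\<close>

lemma frob_inner_eq_inner: "frob_inner A B = A \<bullet> B"
proof -
  have "frob_inner A B = (\<Sum>i\<in>UNIV. \<Sum>k\<in>UNIV. A $ k $ i * B $ k $ i)"
    by (simp add: frob_inner_def trace_def matrix_matrix_mult_def transpose_def)
  also have "\<dots> = A \<bullet> B"
    by (subst sum.swap) (simp add: inner_vec_def)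
  finally show ?thesis .
qed

lemma frob_norm_eq_norm: "frob_norm A = norm A"
  by (simp add: frob_norm_def frob_inner_eq_inner norm_eq_sqrt_inner)

lemma outer_square_nth: "outer_square v $ i $ j = v $ i * v $ j"
  by (simp add: outer_square_def matrix_matrix_mult_def columnvector_def rowvector_def)

lemma inner_outer_square: "A \<bullet> outer_square v = v \<bullet> (A *v v)"
  by (simp add: inner_vec_def outer_square_nth matrix_vector_mult_def sum_distrib_left mult_ac)

lemma transpose_outer_square: "transpose (outer_square v) = outer_square v"
  by (simp add: vec_eq_iff transpose_def outer_square_nth mult.commute)

lemma quadratic_form_outer_square: "v \<bullet> (outer_square u *v v) = (u \<bullet> v)\<^sup>2"
proof -
  have "outer_square u *v v = (u \<bullet> v) *\<^sub>R u"
    by (simp add: vec_eq_iff inner_vec_def outer_square_nth matrix_vector_mult_def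
        sum_distrib_left mult_ac)
  then show ?thesis by (simp add: power2_eq_square inner_commute)
qed

lemma transpose_add: "transpose (A + B) = transpose A + transpose B"
  by (simp add: vec_eq_iff transpose_def)

lemma transpose_diff: "transpose (A - B) = transpose A - transpose B"
  for A B :: "real^'n^'m"
  by (simp add: vec_eq_iff transpose_def)

lemma transpose_scaleR: "transpose (c *\<^sub>R A) = c *\<^sub>R transpose A"
  by (simp add: vec_eq_iff transpose_def)

lemma transpose_sum: "transpose (\<Sum>t\<in>S. f t) = (\<Sum>t\<in>S. transpose (f t))"
  for f :: "'a \<Rightarrow> real^'n^'m"
  by (simp add: vec_eq_iff transpose_def)

lemma transpose_H: "transpose (H x t) = H x t"
  by (cases t) (simp add: transpose_diff transpose_outer_square)

section \<open>Self-duality of the positive semi-definite cone\<close>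

lemma psd_zero: "psd 0"
  by (simp add: psd_def vec_eq_iff transpose_def)

lemma psd_outer_square: "psd (outer_square u)"
  by (simp add: psd_def transpose_outer_square quadratic_form_outer_square)

lemma psd_add: "psd A \<Longrightarrow> psd B \<Longrightarrow> psd (A + B)"
  by (simp add: psd_def transpose_add matrix_vector_mult_add_rdistrib inner_add_right)

lemma psd_scaleR: "psd A \<Longrightarrow> 0 \<le> c \<Longrightarrow> psd (c *\<^sub>R A)"
  by (simp add: psd_def transpose_scaleR scaleR_matrix_vector_assoc[symmetric])

lemma psd_diag_nonneg: "psd A \<Longrightarrow> 0 \<le> A $ k $ k"
  unfolding psd_def
  by (drule conjunct2, drule spec[of _ "axis k 1"])
    (simp add: matrix_vector_mult_basis inner_axis_axis inner_axis' column_def)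

text \<open>The form of \<open>A\<close> at \<open>v - s *\<^sub>R axis k 1\<close>, as a polynomial
  in \<open>s\<close>. It is affine when \<open>A $ k $ k = 0\<close>; otherwise its minimum over
  \<open>s\<close> is the form of the Schur complement.\<close>

lemma psd_form_axis:
  assumes "psd A"
  shows "0 \<le> v \<bullet> (A *v v) - 2 * s * (A $ k \<bullet> v) + s\<^sup>2 * A $ k $ k"
proof -
  let ?e = "axis k 1 :: real^'a"
  have sym: "transpose A = A" using assms by (simp add: psd_def)
  have 1: "?e \<bullet> (A *v v) = A $ k \<bullet> v"
    by (simp add: inner_axis' matrix_vector_mul_component)
  have 2: "v \<bullet> (A *v ?e) = A $ k \<bullet> v"
    using 1 sym by (metis dot_lmul_matrix inner_commute vector_transpose_matrix)
  have 3: "?e \<bullet> (A *v ?e) = A $ k $ k"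
    by (simp add: inner_axis' matrix_vector_mult_basis column_def)
  have "0 \<le> (v - s *\<^sub>R ?e) \<bullet> (A *v (v - s *\<^sub>R ?e))"
    using assms by (simp add: psd_def)
  also have "\<dots> = v \<bullet> (A *v v) - 2 * s * (A $ k \<bullet> v) + s\<^sup>2 * A $ k $ k"
    by (simp add: matrix_vector_mult_diff_distrib matrix_vector_mult_scaleR inner_diff_left
        inner_diff_right 1 2 3 power2_eq_square algebra_simps)
  finally show ?thesis .
qed

lemma nonneg_affine_imp_slope_zero:
  fixes a b :: real
  assumes "\<And>s. 0 \<le> a - s * b"
  shows "b = 0"
proof (rule ccontr)
  assume "b \<noteq> 0"
  \<comment> \<open>At this \<open>s\<close> the affine function takes the value -1.\<close>
  then show False using assms[of "(a + 1) / b"] by simp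
qed

lemma psd_diag_zero_imp_zero:
  assumes "psd A" "\<And>k. A $ k $ k = 0"
  shows "A = 0"
proof -
  have "A $ k $ j = 0" for k j
  proof -
    let ?e = "axis j 1 :: real^'a"
    have "0 \<le> ?e \<bullet> (A *v ?e) - s * (2 * (A $ k \<bullet> ?e))" for s
      using psd_form_axis[OF assms(1), of ?e s k] assms(2) by (simp add: mult_ac)
    from nonneg_affine_imp_slope_zero[OF this] show ?thesis by (simp add: inner_axis)
  qed
  then show ?thesis by (simp add: vec_eq_iff)
qed

lemma psd_schur_complement:
  assumes "psd A" "A $ k $ k > 0"
  shows "psd (A - (1 / A $ k $ k) *\<^sub>R outer_square (A $ k))"
proof -
  have "0 \<le> v \<bullet> (A *v v) - (A $ k \<bullet> v)\<^sup>2 / A $ k $ k" for v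
    \<comment> \<open>This \<open>s\<close> minimizes the quadratic polynomial.\<close>
    using psd_form_axis[OF assms(1), of v "(A $ k \<bullet> v) / A $ k $ k" k] assms(2)
    by (simp add: power2_eq_square field_simps)
  then show ?thesis using assms(1)
    by (simp add: psd_def transpose_diff transpose_scaleR transpose_outer_square
        matrix_vector_mult_diff_rdistrib inner_diff_right
        scaleR_matrix_vector_assoc[symmetric] quadratic_form_outer_square)
qed

text \<open>Each Schur complement step peels a rank-one positive semi-definite matrix off \<open>B\<close> and clears
  one more diagonal entry, which avoids the spectral theorem.\<close>

lemma psd_inner_nonneg:
  assumes "psd A" "psd B"
  shows "0 \<le> A \<bullet> B"
  using assms(2)
proof (induction "card {k. B $ k $ k \<noteq> 0}" arbitrary: B rule: less_induct)
  case less
  show ?case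
  proof (cases "\<exists>k. B $ k $ k \<noteq> 0")
    case False
    then show ?thesis using psd_diag_zero_imp_zero[OF less.prems] by simp
  next
    case True
    then obtain k where "B $ k $ k \<noteq> 0" ..
    then have k: "B $ k $ k > 0" using psd_diag_nonneg[OF less.prems, of k] by simp
    define C where "C = B - (1 / B $ k $ k) *\<^sub>R outer_square (B $ k)"
    have C: "psd C" unfolding C_def by (rule psd_schur_complement[OF less.prems k])
    have diag: "C $ j $ j = B $ j $ j - (B $ k $ j)\<^sup>2 / B $ k $ k" for j
      by (simp add: C_def outer_square_nth power2_eq_square)
    have "C $ k $ k = 0" using k by (simp add: diag power2_eq_square)
    \<comment> \<open>Zeros on the diagonal survive: \<open>C $ j $ j\<close> is at most
      \<open>B $ j $ j\<close> and, as \<open>C\<close> is psd, nonnegative.\<close>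
    moreover have "C $ j $ j = 0" if "B $ j $ j = 0" for j
    proof -
      have "0 \<le> (B $ k $ j)\<^sup>2 / B $ k $ k" using k by simp
      with psd_diag_nonneg[OF C, of j] that show ?thesis by (simp add: diag)
    qed
    ultimately have "{j. C $ j $ j \<noteq> 0} \<subset> {j. B $ j $ j \<noteq> 0}"
      using \<open>B $ k $ k \<noteq> 0\<close> by blast
    then have "0 \<le> A \<bullet> C" by (intro less.hyps[OF _ C] psubset_card_mono) simp_all
    moreover have "0 \<le> A \<bullet> outer_square (B $ k)"
      using assms(1) by (simp add: inner_outer_square psd_def)
    moreover have "A \<bullet> B = A \<bullet> C + (1 / B $ k $ k) * (A \<bullet> outer_square (B $ k))"
      by (simp add: C_def inner_diff_right)
    ultimately show ?thesis using k by simp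
  qed
qed

text \<open>Rank-one test matrices suffice: pairing with \<open>outer_square v\<close> evaluates the
  quadratic form at \<open>v\<close>.\<close>

lemma psd_if_inner_nonneg:
  assumes "transpose A = A" "\<And>G. psd G \<Longrightarrow> 0 \<le> A \<bullet> G"
  shows "psd A"
  using assms psd_outer_square by (metis psd_def inner_outer_square)

section \<open>Conjugate representation of the loss\<close>

lemma fenchel_young_loss:
  assumes "0 \<le> \<gamma>" "0 \<le> a" "a \<le> 1"
  shows "a * (1 - z) - \<gamma> / 2 * a\<^sup>2 \<le> loss \<gamma> z"
proof (cases "\<gamma> = 0")
  case True
  then show ?thesis using assms by (cases "z \<le> 1")
      (auto simp: loss_def mult_left_le_one_le mult_le_0_iff max_def)
next
  case False
  then have \<gamma>: "\<gamma> > 0" using assms by simp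
  consider "z > 1" | "z < 1 - \<gamma>" | "1 - \<gamma> \<le> z" "z \<le> 1" by linarith
  then show ?thesis
  proof cases
    case 1
    then have "a * (1 - z) \<le> 0" "0 \<le> \<gamma> / 2 * a\<^sup>2"
      using assms by (auto simp: mult_le_0_iff)
    then have "a * (1 - z) - \<gamma> / 2 * a\<^sup>2 \<le> 0" by linarith
    then show ?thesis using 1 False by (simp add: loss_def)
  next
    case 2
    \<comment> \<open>The slack of the inequality is the first product plus half the second.\<close>
    have "0 \<le> (1 - a) * (1 - z - \<gamma>)" "0 \<le> \<gamma> * (1 - a)\<^sup>2" using 2 assms by auto
    then have "a * (1 - z) - \<gamma> / 2 * a\<^sup>2 \<le> 1 - z - \<gamma> / 2"
      by (simp add: power2_eq_square algebra_simps)
    then show ?thesis using 2 False \<gamma> by (simp add: loss_def)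
  next
    case 3
    \<comment> \<open>On the quadratic branch the slack is this perfect square.\<close>
    have "0 \<le> (1 - z - \<gamma> * a)\<^sup>2 / (2 * \<gamma>)" using \<gamma> by simp
    also have "\<dots> = 1 / (2 * \<gamma>) * (1 - z)\<^sup>2 - (a * (1 - z) - \<gamma> / 2 * a\<^sup>2)"
      using \<gamma> by (simp add: power2_eq_square field_simps)
    finally show ?thesis using 3 False by (simp add: loss_def)
  qed
qed

text \<open>\<open>opt\<close> is the variational inequality for maximizing
  \<open>b * (1 - z) - \<gamma> / 2 * b\<^sup>2\<close> over [0,1] at \<open>a\<close>. An endpoint
  puts \<open>z\<close> on a flat or linear piece of the loss, and an interior point must be
  stationary.\<close>

lemma fenchel_young_loss_eq:
  assumes "0 \<le> \<gamma>" "0 \<le> a" "a \<le> 1"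
    and opt: "\<And>b. 0 \<le> b \<Longrightarrow> b \<le> 1 \<Longrightarrow> (b - a) * (1 - z - \<gamma> * a) \<le> 0"
  shows "loss \<gamma> z = a * (1 - z) - \<gamma> / 2 * a\<^sup>2"
proof -
  have low: "- a * (1 - z - \<gamma> * a) \<le> 0" and high: "(1 - a) * (1 - z - \<gamma> * a) \<le> 0"
    using opt[of 0] opt[of 1] by auto
  consider "a = 0" | "a = 1" | "0 < a" "a < 1" using assms by linarith
  then show ?thesis
  proof cases
    case 1
    then have "1 \<le> z" using high by simp
    then show ?thesis using 1 assms by (auto simp: loss_def)
  next
    case 2
    then have "z \<le> 1 - \<gamma>" using low by simp
    then show ?thesis using 2 assms
      \<comment> \<open>For positive \<gamma> the breakpoint belongs to the quadratic branch of
        \<open>loss\<close>, hence the split.\<close>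
      by (cases "z = 1 - \<gamma>") (auto simp: loss_def power2_eq_square)
  next
    case 3
    then have z: "z = 1 - \<gamma> * a" using low high by (auto simp: mult_le_0_iff zero_le_mult_iff)
    have "\<gamma> * a \<le> \<gamma>" "0 \<le> \<gamma> * a" using assms by (auto simp: mult_left_le)
    moreover have "1 / (2 * \<gamma>) * (\<gamma> * a)\<^sup>2 = a * (\<gamma> * a) - \<gamma> / 2 * a\<^sup>2" if "\<gamma> \<noteq> 0"
      using that by (simp add: power2_eq_square field_simps)
    ultimately show ?thesis unfolding z by (auto simp: loss_def)
  qed
qed

text \<open>Dividing by \<open>s\<close> and letting \<open>s\<close> tend to 0 gives the claim; a
  sufficiently small explicit \<open>s\<close> replaces the limit.\<close>

lemma nonpos_slope_if_quadratic_nonpos: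
  fixes b c :: real
  assumes "\<And>s. 0 < s \<Longrightarrow> s \<le> 1 \<Longrightarrow> s * b - s\<^sup>2 * c \<le> 0"
  shows "b \<le> 0"
proof (rule ccontr)
  assume "\<not> b \<le> 0"
  then have b: "b > 0" by simp
  \<comment> \<open>Chosen to give both \<open>s \<le> 1\<close> and
    \<open>s * \<bar>c\<bar> < b\<close>.\<close>
  define s where "s = b / (b + \<bar>c\<bar>)"
  have s: "0 < s" "s \<le> 1" using b by (auto simp: s_def)
  then have "s * (b - s * c) \<le> 0"
    using assms[OF s] by (simp add: power2_eq_square algebra_simps)
  then have "b \<le> s * c" using s by (simp add: mult_le_0_iff)
  also have "\<dots> \<le> s * \<bar>c\<bar>" using s by (simp add: mult_left_mono)
  also have "\<dots> < b" using b by (simp add: s_def field_simps)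
  finally show False by simp
qed

section \<open>The dual matrix and exact expansions of the dual objective\<close>

lemma finite_triplets: "finite (triplets n y)"
  by (rule finite_subset[of _ "{1..n} \<times> {1..n} \<times> {1..n}"]) (auto simp: triplets_def)

lemma dual_matrix_scaleR:
  assumes "lam \<noteq> 0"
  shows "lam *\<^sub>R dual_matrix n x y lam \<alpha> \<Gamma> = (\<Sum>t\<in>triplets n y. \<alpha> t *\<^sub>R H x t) + \<Gamma>"
  using assms by (simp add: dual_matrix_def)

lemma sum_mult_inner_H:
  assumes "lam \<noteq> 0"
  shows "(\<Sum>t\<in>triplets n y. \<alpha> t * (A \<bullet> H x t)) = lam * (A \<bullet> dual_matrix n x y lam \<alpha> \<Gamma>) - A \<bullet> \<Gamma>"
proof -
  have "lam * (A \<bullet> dual_matrix n x y lam \<alpha> \<Gamma>) = A \<bullet> ((\<Sum>t\<in>triplets n y. \<alpha> t *\<^sub>R H x t) + \<Gamma>)"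
    by (simp only: dual_matrix_scaleR[OF assms, symmetric] inner_scaleR_right)
  then show ?thesis by (simp add: inner_add_right inner_sum_right)
qed

lemma transpose_dual_matrix:
  assumes "transpose \<Gamma> = \<Gamma>"
  shows "transpose (dual_matrix n x y lam \<alpha> \<Gamma>) = dual_matrix n x y lam \<alpha> \<Gamma>"
  using assms
  by (simp add: dual_matrix_def transpose_scaleR transpose_add transpose_sum transpose_H)

lemma norm_add_scaleR_square: "(norm (A + s *\<^sub>R B))\<^sup>2 = (norm A)\<^sup>2 + 2 * s * (A \<bullet> B) + s\<^sup>2 * (norm B)\<^sup>2"
  unfolding power2_norm_eq_inner
  by (simp add: inner_add_left inner_add_right inner_commute power2_eq_square algebra_simps)

lemma half_norm_add_scaleR_square:
  assumes "lam \<noteq> 0"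
  shows "lam / 2 * (norm (A + (s / lam) *\<^sub>R B))\<^sup>2
    = lam / 2 * (norm A)\<^sup>2 + s * (A \<bullet> B) + s\<^sup>2 * ((norm B)\<^sup>2 / (2 * lam))"
  using assms unfolding norm_add_scaleR_square by (simp add: power2_eq_square field_simps)

text \<open>The objective is quadratic, so this expansion has no remainder; its linear term supplies
  the derivative for the first-order condition in \<Gamma>.\<close>

lemma dual_obj_add_matrix:
  assumes "lam \<noteq> 0"
  shows "dual_obj \<gamma> n x y lam \<alpha> (\<Gamma> + s *\<^sub>R \<Delta>) = dual_obj \<gamma> n x y lam \<alpha> \<Gamma>
    - s * (dual_matrix n x y lam \<alpha> \<Gamma> \<bullet> \<Delta>) - s\<^sup>2 * ((norm \<Delta>)\<^sup>2 / (2 * lam))"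
proof -
  have "dual_matrix n x y lam \<alpha> (\<Gamma> + s *\<^sub>R \<Delta>) = dual_matrix n x y lam \<alpha> \<Gamma> + (s / lam) *\<^sub>R \<Delta>"
    by (simp add: dual_matrix_def scaleR_add_right)
  then show ?thesis
    by (simp only: dual_obj_def frob_norm_eq_norm half_norm_add_scaleR_square[OF assms])
qed

lemma dual_obj_fun_upd:
  assumes "lam \<noteq> 0" "t \<in> triplets n y"
  shows "dual_obj \<gamma> n x y lam (\<alpha>(t := \<alpha> t + s)) \<Gamma> = dual_obj \<gamma> n x y lam \<alpha> \<Gamma>
    + s * (1 - dual_matrix n x y lam \<alpha> \<Gamma> \<bullet> H x t - \<gamma> * \<alpha> t)
    - s\<^sup>2 * (\<gamma> / 2 + (norm (H x t))\<^sup>2 / (2 * lam))"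
proof -
  let ?\<alpha> = "\<alpha>(t := \<alpha> t + s)"
  note split = sum.remove[OF finite_triplets assms(2)]
  have sum1: "(\<Sum>u\<in>triplets n y. ?\<alpha> u) = (\<Sum>u\<in>triplets n y. \<alpha> u) + s"
    by (simp add: split)
  have sum2: "(\<Sum>u\<in>triplets n y. (?\<alpha> u)\<^sup>2) = (\<Sum>u\<in>triplets n y. (\<alpha> u)\<^sup>2) + 2 * s * \<alpha> t + s\<^sup>2"
    by (simp add: split power2_sum)
  have "(\<Sum>u\<in>triplets n y. ?\<alpha> u *\<^sub>R H x u) = (\<Sum>u\<in>triplets n y. \<alpha> u *\<^sub>R H x u) + s *\<^sub>R H x t"
    by (simp add: split scaleR_add_left)
  then have "dual_matrix n x y lam ?\<alpha> \<Gamma> = dual_matrix n x y lam \<alpha> \<Gamma> + (s / lam) *\<^sub>R H x t"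
    by (simp only: dual_matrix_def scaleR_add_right) simp
  then show ?thesis unfolding dual_obj_def sum1 sum2 frob_norm_eq_norm
    by (simp only: half_norm_add_scaleR_square[OF assms(1)]) (simp add: algebra_simps)
qed

section \<open>First-order conditions and strong duality\<close>

lemma dual_optimalD:
  assumes "dual_optimal \<gamma> n x y lam \<alpha> \<Gamma>"
  shows "dual_feasible n y \<alpha> \<Gamma>"
    and "dual_feasible n y a G \<Longrightarrow> dual_obj \<gamma> n x y lam a G \<le> dual_obj \<gamma> n x y lam \<alpha> \<Gamma>"
  using assms by (auto simp: dual_optimal_def is_arg_max_linorder)

text \<open>Moving from \<Gamma> towards \<open>G\<close> stays in the convex cone, so the one-sided
  derivative of the dual objective along this segment is nonpositive.\<close>

lemma dual_optimal_matrix_condition: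
  assumes "lam > 0" and opt: "dual_optimal \<gamma> n x y lam \<alpha> \<Gamma>" and "psd G"
  shows "dual_matrix n x y lam \<alpha> \<Gamma> \<bullet> \<Gamma> \<le> dual_matrix n x y lam \<alpha> \<Gamma> \<bullet> G"
proof -
  let ?M = "dual_matrix n x y lam \<alpha> \<Gamma>"
  have feas: "dual_feasible n y \<alpha> \<Gamma>" by (rule dual_optimalD[OF opt])
  have "- (?M \<bullet> (G - \<Gamma>)) \<le> 0"
  proof (rule nonpos_slope_if_quadratic_nonpos)
    fix s :: real assume s: "0 < s" "s \<le> 1"
    have "\<Gamma> + s *\<^sub>R (G - \<Gamma>) = (1 - s) *\<^sub>R \<Gamma> + s *\<^sub>R G" by (simp add: algebra_simps)
    then have "dual_feasible n y \<alpha> (\<Gamma> + s *\<^sub>R (G - \<Gamma>))"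
      using feas s \<open>psd G\<close> by (simp add: dual_feasible_def psd_add psd_scaleR)
    from dual_optimalD(2)[OF opt this]
    show "s * - (?M \<bullet> (G - \<Gamma>)) - s\<^sup>2 * ((norm (G - \<Gamma>))\<^sup>2 / (2 * lam)) \<le> 0"
      using \<open>lam > 0\<close> by (simp add: dual_obj_add_matrix)
  qed
  then show ?thesis by (simp add: inner_diff_right)
qed

text \<open>The box is a product of intervals, so one coordinate can be varied alone. The result is
  the \<open>opt\<close> hypothesis of \<open>fenchel_young_loss_eq\<close> at the margin of
  \<open>t\<close>.\<close>

lemma dual_optimal_vector_condition:
  assumes "lam > 0" and opt: "dual_optimal \<gamma> n x y lam \<alpha> \<Gamma>"
    and t: "t \<in> triplets n y" and b: "0 \<le> b" "b \<le> 1"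
  shows "(b - \<alpha> t) * (1 - dual_matrix n x y lam \<alpha> \<Gamma> \<bullet> H x t - \<gamma> * \<alpha> t) \<le> 0"
proof (rule nonpos_slope_if_quadratic_nonpos)
  have feas: "dual_feasible n y \<alpha> \<Gamma>" by (rule dual_optimalD[OF opt])
  fix s :: real assume s: "0 < s" "s \<le> 1"
  have a: "0 \<le> \<alpha> t" "\<alpha> t \<le> 1" using feas t by (auto simp: dual_feasible_def)
  have "\<alpha> t + s * (b - \<alpha> t) = (1 - s) * \<alpha> t + s * b" by (simp add: algebra_simps)
  moreover have "0 \<le> (1 - s) * \<alpha> t + s * b" using s a b by simp
  moreover have "(1 - s) * \<alpha> t + s * b \<le> 1" using s a b by (intro convex_bound_le) auto
  ultimately have "dual_feasible n y (\<alpha>(t := \<alpha> t + s * (b - \<alpha> t))) \<Gamma>"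
    using feas by (simp add: dual_feasible_def)
  from dual_optimalD(2)[OF opt this]
  show "s * ((b - \<alpha> t) * (1 - dual_matrix n x y lam \<alpha> \<Gamma> \<bullet> H x t - \<gamma> * \<alpha> t))
      - s\<^sup>2 * ((b - \<alpha> t)\<^sup>2 * (\<gamma> / 2 + (norm (H x t))\<^sup>2 / (2 * lam))) \<le> 0"
    using \<open>lam > 0\<close> t by (simp add: dual_obj_fun_upd power_mult_distrib mult.assoc)
qed

text \<open>Weak duality sharpened by strong convexity: sum Fenchel-Young over the triplets, drop
  \<open>A \<bullet> \<Gamma> \<ge> 0\<close>, and complete the square. The quadratic surplus later
  yields uniqueness of the minimizer.\<close>

lemma duality_gap_lower_bound:
  assumes "0 \<le> \<gamma>" "lam > 0" "psd A" "dual_feasible n y \<alpha> \<Gamma>"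
  shows "dual_obj \<gamma> n x y lam \<alpha> \<Gamma> + lam / 2 * (norm (A - dual_matrix n x y lam \<alpha> \<Gamma>))\<^sup>2
    \<le> primal_obj \<gamma> n x y lam A"
proof -
  let ?M = "dual_matrix n x y lam \<alpha> \<Gamma>" and ?T = "triplets n y"
  have "0 \<le> A \<bullet> \<Gamma>" using assms by (simp add: psd_inner_nonneg dual_feasible_def)
  moreover have "(\<Sum>t\<in>?T. \<alpha> t * (1 - A \<bullet> H x t) - \<gamma> / 2 * (\<alpha> t)\<^sup>2) \<le> (\<Sum>t\<in>?T. loss \<gamma> (A \<bullet> H x t))"
    using assms by (intro sum_mono fenchel_young_loss) (auto simp: dual_feasible_def)
  moreover have "(\<Sum>t\<in>?T. \<alpha> t * (1 - A \<bullet> H x t) - \<gamma> / 2 * (\<alpha> t)\<^sup>2)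
      = (\<Sum>t\<in>?T. \<alpha> t) - \<gamma> / 2 * (\<Sum>t\<in>?T. (\<alpha> t)\<^sup>2) - (lam * (A \<bullet> ?M) - A \<bullet> \<Gamma>)"
    using assms(2) by (simp add: sum_mult_inner_H[of lam, symmetric]
        sum_subtractf sum_distrib_left right_diff_distrib)
  moreover have "lam / 2 * (norm (A - ?M))\<^sup>2
      = lam / 2 * (norm A)\<^sup>2 - lam * (A \<bullet> ?M) + lam / 2 * (norm ?M)\<^sup>2"
    using half_norm_add_scaleR_square[of lam A "- lam" ?M] assms(2)
    by (simp add: power2_eq_square)
  ultimately show ?thesis
    unfolding primal_obj_def dual_obj_def frob_norm_eq_norm frob_inner_eq_inner by linarith
qed

lemma strong_duality:
  assumes "0 \<le> \<gamma>" "lam > 0" and opt: "dual_optimal \<gamma> n x y lam \<alpha> \<Gamma>"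
  defines "M \<equiv> dual_matrix n x y lam \<alpha> \<Gamma>"
  shows "psd M" and "primal_obj \<gamma> n x y lam M = dual_obj \<gamma> n x y lam \<alpha> \<Gamma>"
proof -
  let ?T = "triplets n y"
  have feas: "dual_feasible n y \<alpha> \<Gamma>" by (rule dual_optimalD[OF opt])
  then have \<Gamma>: "psd \<Gamma>" by (simp add: dual_feasible_def)
  note foc = dual_optimal_matrix_condition[OF \<open>lam > 0\<close> opt, folded M_def]
  \<comment> \<open>Complementary slackness: comparing \<Gamma> with 0 and with twice itself bounds
    the product from both sides.\<close>
  have orth: "M \<bullet> \<Gamma> = 0"
    using foc[OF psd_zero] foc[OF psd_scaleR[OF \<Gamma>, of 2]] by simp
  show "psd M"
  proof (rule psd_if_inner_nonneg)
    show "transpose M = M"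
      unfolding M_def using \<Gamma> by (intro transpose_dual_matrix) (simp add: psd_def)
    show "0 \<le> M \<bullet> G" if "psd G" for G using foc[OF that] orth by simp
  qed
  have "loss \<gamma> (M \<bullet> H x t) = \<alpha> t * (1 - M \<bullet> H x t) - \<gamma> / 2 * (\<alpha> t)\<^sup>2" if "t \<in> ?T" for t
    using assms feas that unfolding M_def
    by (intro fenchel_young_loss_eq dual_optimal_vector_condition[OF _ opt])
      (auto simp: dual_feasible_def)
  then have "(\<Sum>t\<in>?T. loss \<gamma> (M \<bullet> H x t))
      = (\<Sum>t\<in>?T. \<alpha> t) - \<gamma> / 2 * (\<Sum>t\<in>?T. (\<alpha> t)\<^sup>2) - (\<Sum>t\<in>?T. \<alpha> t * (M \<bullet> H x t))"
    by (simp add: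
        sum_subtractf sum_distrib_left right_diff_distrib)
  \<comment> \<open>By orthogonality the \<Gamma> term vanishes.\<close>
  also have "(\<Sum>t\<in>?T. \<alpha> t * (M \<bullet> H x t)) = lam * (norm M)\<^sup>2"
    using sum_mult_inner_H[of lam \<alpha> M x n y \<Gamma>, folded M_def] orth \<open>lam > 0\<close>
    by (simp add: power2_norm_eq_inner)
  finally show "primal_obj \<gamma> n x y lam M = dual_obj \<gamma> n x y lam \<alpha> \<Gamma>"
    by (simp add: primal_obj_def dual_obj_def frob_norm_eq_norm frob_inner_eq_inner
        M_def[symmetric])
qed

lemma primal_optimal_eq_dual_matrix:
  assumes "0 \<le> \<gamma>" "lam > 0"
    and "primal_optimal \<gamma> n x y lam M" and opt: "dual_optimal \<gamma> n x y lam \<alpha> \<Gamma>"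
  shows "M = dual_matrix n x y lam \<alpha> \<Gamma>"
proof -
  let ?M = "dual_matrix n x y lam \<alpha> \<Gamma>"
  have "psd M" "primal_obj \<gamma> n x y lam M \<le> primal_obj \<gamma> n x y lam ?M"
    using assms(3) strong_duality(1)[OF assms(1,2) opt]
    by (auto simp: primal_optimal_def is_arg_min_linorder)
  with duality_gap_lower_bound[OF assms(1,2) _ dual_optimalD(1)[OF opt], of M x]
    strong_duality(2)[OF assms(1,2) opt]
  have "lam / 2 * (norm (M - ?M))\<^sup>2 \<le> 0" by simp
  then show ?thesis using \<open>lam > 0\<close> by (simp add: mult_le_0_iff)
qed

theorem theorem3p9:
  fixes n :: nat
    and x :: "nat \<Rightarrow> real^'d"
    and y :: "nat \<Rightarrow> 'label"
    and \<gamma> lam0 lam1 :: real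
    and M0 \<Gamma>0 :: "real^'d^'d"
    and \<alpha>0 :: "nat \<times> nat \<times> nat \<Rightarrow> real"
  assumes "\<gamma> \<ge> 0"
    and "lam0 > 0" and "lam1 > 0"
    and "primal_optimal \<gamma> n x y lam0 M0"
    and "dual_optimal \<gamma> n x y lam0 \<alpha>0 \<Gamma>0"
  shows "dgb_radius \<gamma> n x y lam1 M0 \<alpha>0 \<Gamma>0 = 2 * rpb_radius lam0 lam1 M0 \<and>
         rpb lam0 lam1 M0 \<subseteq> dgb \<gamma> n x y lam1 M0 \<alpha>0 \<Gamma>0"
proof -
  have M0: "M0 = dual_matrix n x y lam0 \<alpha>0 \<Gamma>0"
    using assms by (intro primal_optimal_eq_dual_matrix)
  have gap0: "primal_obj \<gamma> n x y lam0 M0 = dual_obj \<gamma> n x y lam0 \<alpha>0 \<Gamma>0"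
    unfolding M0 using assms by (intro strong_duality)
  \<comment> \<open>The bracket in \<open>dual_matrix\<close> is independent of the regularization
    parameter; only the prefactor changes.\<close>
  have M1: "dual_matrix n x y lam1 \<alpha>0 \<Gamma>0 = (lam0 / lam1) *\<^sub>R M0"
    unfolding M0 dual_matrix_def using \<open>lam0 > 0\<close> by simp
  \<comment> \<open>The terms are the change of the primal regularizer, then the dual regularizer at
    \<open>lam0\<close> removed and the one at \<open>lam1\<close> inserted; everything else cancels
    by \<open>gap0\<close>.\<close>
  have "primal_obj \<gamma> n x y lam1 M0 - dual_obj \<gamma> n x y lam1 \<alpha>0 \<Gamma>0
      = (lam1 - lam0) / 2 * (norm M0)\<^sup>2 - lam0 / 2 * (norm M0)\<^sup>2
        + lam1 / 2 * (lam0 / lam1 * norm M0)\<^sup>2"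
    using gap0 assms(2,3)
    by (simp add: primal_obj_def dual_obj_def frob_norm_eq_norm M1 M0[symmetric] algebra_simps
        diff_divide_distrib)
  also have "\<dots> = (lam0 - lam1)\<^sup>2 / (2 * lam1) * (norm M0)\<^sup>2"
    using \<open>lam1 > 0\<close> by (simp add: power2_eq_square field_simps)
  \<comment> \<open>The absolute value makes the base nonnegative, so the square root in the radius
    returns it unchanged.\<close>
  finally have "2 * (primal_obj \<gamma> n x y lam1 M0 - dual_obj \<gamma> n x y lam1 \<alpha>0 \<Gamma>0) / lam1
      = (\<bar>lam0 - lam1\<bar> / lam1 * norm M0)\<^sup>2"
    using \<open>lam1 > 0\<close> by (simp add: power_mult_distrib power_divide power2_eq_square)
  then have radius: "dgb_radius \<gamma> n x y lam1 M0 \<alpha>0 \<Gamma>0 = 2 * rpb_radius lam0 lam1 M0"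
    using \<open>lam1 > 0\<close> by (simp add: dgb_radius_def rpb_radius_def frob_norm_eq_norm)
  let ?C = "((lam0 + lam1) / (2 * lam1)) *\<^sub>R M0"
  have "?C - M0 = ((lam0 - lam1) / (2 * lam1)) *\<^sub>R M0"
  proof -
    have "(lam0 + lam1) / (2 * lam1) - 1 = (lam0 - lam1) / (2 * lam1)"
      using \<open>lam1 > 0\<close> by (simp add: field_simps)
    then show ?thesis by (metis scaleR_left_diff_distrib scaleR_one)
  qed
  then have center: "norm (?C - M0) = rpb_radius lam0 lam1 M0"
    using \<open>lam1 > 0\<close> by (simp add: rpb_radius_def frob_norm_eq_norm)
  have "rpb lam0 lam1 M0 \<subseteq> dgb \<gamma> n x y lam1 M0 \<alpha>0 \<Gamma>0"
  proof
    fix X assume "X \<in> rpb lam0 lam1 M0"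
    then have "norm (X - ?C) \<le> rpb_radius lam0 lam1 M0"
      by (simp add: rpb_def frob_cball_def frob_norm_eq_norm)
    moreover have "norm (X - M0) \<le> norm (X - ?C) + norm (?C - M0)"
      using norm_triangle_ineq[of "X - ?C" "?C - M0"] by simp
    ultimately have "norm (X - M0) \<le> dgb_radius \<gamma> n x y lam1 M0 \<alpha>0 \<Gamma>0"
      using center radius by simp
    then show "X \<in> dgb \<gamma> n x y lam1 M0 \<alpha>0 \<Gamma>0"
      by (simp add: dgb_def frob_cball_def frob_norm_eq_norm)
  qed
  with radius show ?thesis by blast
qed

end
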